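(* Let $H^4_2$ denote the $4$-graph on $5$ vertices with exactly $2$ edges. Then \[ f^{(4)}_{H^4_2,6}(N)\le O\big((\log\log N)^2\big). \]
   Context: A $4$-graph is a $4$-uniform hypergraph; $K_6^{(4)}$ is the complete $4$-graph on $6$ vertices. For $4$-graphs $F$ and $H$, a set $S\subseteq V(H)$ is $F$-independent if $H[S]$ contains no copy of $F$, and $\alpha_F(H)$ is the largest size of an $F$-independent set in $H$. The generalized Erdős–Rogers function is $f^{(4)}_{F,6}(N)=\min\{\alpha_F(H): |V(H)|=N,\ H \text{ is a } K_6^{(4)}\text{-free } 4\text{-graph}\}$. Logarithms are base $2$. *)

theory Defs
  imports Complex_Main "HOL-Library.Landau_Symbols"
begin

type_synonym 'a hypergraph = "'a set \<times> 'a set set"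

abbreviation verts :: "'a hypergraph \<Rightarrow> 'a set" where
  "verts H \<equiv> fst H"

abbreviation edges :: "'a hypergraph \<Rightarrow> 'a set set" where
  "edges H \<equiv> snd H"

definition uniform_hypergraph :: "nat \<Rightarrow> 'a hypergraph \<Rightarrow> bool" where
  "uniform_hypergraph k H \<longleftrightarrow>
     finite (verts H) \<and> (\<forall>e\<in>edges H. e \<subseteq> verts H \<and> card e = k)"

definition complete_hypergraph :: "nat \<Rightarrow> nat \<Rightarrow> nat hypergraph" where
  "complete_hypergraph k n = ({..<n}, {e. e \<subseteq> {..<n} \<and> card e = k})"

definition induced :: "'a hypergraph \<Rightarrow> 'a set \<Rightarrow> 'a hypergraph" where
  "induced H S = (S, {e \<in> edges H. e \<subseteq> S})"

(* A copy is a subgraph isomorphic to F, not necessarily an induced one. *)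
definition contains_copy :: "'a hypergraph \<Rightarrow> 'b hypergraph \<Rightarrow> bool" where
  "contains_copy F H \<longleftrightarrow>
     (\<exists>\<phi>. inj_on \<phi> (verts F) \<and> \<phi> ` verts F \<subseteq> verts H \<and> (\<forall>e\<in>edges F. \<phi> ` e \<in> edges H))"

definition indep_set :: "'a hypergraph \<Rightarrow> 'b hypergraph \<Rightarrow> 'b set \<Rightarrow> bool" where
  "indep_set F H S \<longleftrightarrow> S \<subseteq> verts H \<and> \<not> contains_copy F (induced H S)"

definition indep_number :: "'a hypergraph \<Rightarrow> 'b hypergraph \<Rightarrow> nat" where
  "indep_number F H = Max {card S | S. indep_set F H S}"

(* Vertices are taken in nat, which realises every finite hypergraph up to isomorphism.
   The set below is nonempty whenever s \<ge> k (it contains the edgeless hypergraph), so its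
   infimum in nat is attained, i.e. it is the minimum. *)
definition erdos_rogers :: "nat \<Rightarrow> 'a hypergraph \<Rightarrow> nat \<Rightarrow> nat \<Rightarrow> nat" where
  "erdos_rogers k F s N =
     Inf {indep_number F H | H :: nat hypergraph.
            uniform_hypergraph k H \<and> card (verts H) = N \<and>
            \<not> contains_copy (complete_hypergraph k s) H}"

end

theory Submission
  imports Defs "HOL-Library.Disjoint_Sets"
begin

text \<open>
  A stepping-up construction over a random colouring. Regard vertices as leaves of a binary trie of
  height \<open>D = 2 ^ d\<close>, where \<open>\<delta> x y\<close> is the height of the branching node of \<open>x\<close> and \<open>y\<close>. Some
  2-colouring \<open>\<phi>\<close> of pairs of levels has the pattern \<open>\<phi> x y\<close>, \<open>\<not> \<phi> x z\<close>, \<open>\<phi> y z\<close> with \<open>x > y > z\<close> in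
  every set of \<open>48 d\<close> levels. Whether four vertices form an edge is decided by the shape of their
  subtree and by \<open>\<phi>\<close> on its three levels; the conditions attached to different shapes contradict each
  other on every trie with six leaves.

  Let \<open>S\<close> span no two edges on five vertices. The pattern bounds by \<open>48 d\<close> the number of left turns
  and of right turns on every path of the trie of \<open>S\<close>. The balanced shapes force the colours from a
  branching node to be \<open>\<not> \<phi>\<close> towards its left and \<open>\<phi>\<close> towards its right subtree, and then
  the right-left zigzags would be edges. So to the right of a branching with at least two leaves on its
  left, every branching has at most two leaves on one side; such a subtree has \<open>O(d)\<close> leaves, and \<open>S\<close>
  is a path with subtrees of that size attached.
\<close>

section \<open>Counting: colourings with the pattern in every large set of levels\<close>

text \<open>Independence in counting form: each of the disjoint triples rules out one of its 8
  membership patterns, so at most a fraction (7/8)^|I| of the subsets of \<open>E\<close>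
  survives.\<close>

lemma card_avoiding:
  fixes a b c :: "'i \<Rightarrow> 'e"
  assumes "finite I" "finite E"
    and "\<And>i. i \<in> I \<Longrightarrow> card {a i, b i, c i} = 3" "\<And>i. i \<in> I \<Longrightarrow> {a i, b i, c i} \<subseteq> E"
    and "disjoint_family_on (\<lambda>i. {a i, b i, c i}) I"
  shows "card {G. G \<subseteq> E \<and> (\<forall>i\<in>I. \<not> (a i \<in> G \<and> b i \<notin> G \<and> c i \<in> G))} * 8 ^ card I \<le> 7 ^ card I * 2 ^ card E"
  using assms
proof (induction I arbitrary: E rule: finite_induct)
  case empty
  then show ?case by (simp add: card_Pow flip: Pow_def)
next
  case (insert j I)
  let ?T = "{a j, b j, c j}"
  let ?B = "\<lambda>E I. {G. G \<subseteq> E \<and> (\<forall>i\<in>I. \<not> (a i \<in> G \<and> b i \<notin> G \<and> c i \<in> G))}"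
  have T: "card ?T = 3" "?T \<subseteq> E" using insert.prems by auto
  have disj: "?T \<inter> {a i, b i, c i} = {}" if "i \<in> I" for i
    using insert.prems(4) insert.hyps(2) that unfolding disjoint_family_on_def by (metis insertCI)
  have IH: "card (?B (E - ?T) I) * 8 ^ card I \<le> 7 ^ card I * 2 ^ card (E - ?T)"
  proof (rule insert.IH)
    show "{a i, b i, c i} \<subseteq> E - ?T" if "i \<in> I" for i
      using insert.prems(3)[of i] disj[OF that] that by blast
    show "disjoint_family_on (\<lambda>i. {a i, b i, c i}) I"
      using insert.prems(4) by (rule disjoint_family_on_mono[rotated]) auto
  qed (use insert.prems in auto)
  have fin: "finite (?B (E - ?T) I)" using insert.prems(1) by simp
  have ne: "{a j, c j} \<in> Pow ?T" by auto
  have c7: "card (Pow ?T - {{a j, c j}}) = 7"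
    using T(1) ne by (simp add: card_Diff_singleton card_Pow del: Pow_iff)
  \<comment> \<open>The condition for \<open>j\<close> excludes exactly the trace
    \<open>{a j, c j}\<close> on \<open>?T\<close>, and by disjointness the conditions for
    \<open>I\<close> depend only on \<open>G - ?T\<close>.\<close>
  have inj: "inj_on (\<lambda>G. (G \<inter> ?T, G - ?T)) (?B E (insert j I))"
    by (rule inj_onI) blast
  have "b j \<noteq> a j" "b j \<noteq> c j"
    using T(1) by (auto simp: card_insert_if split: if_splits)
  then have sub: "(\<lambda>G. (G \<inter> ?T, G - ?T)) ` ?B E (insert j I) \<subseteq> (Pow ?T - {{a j, c j}}) \<times> ?B (E - ?T) I"
    using disj by auto
  have "card (?B E (insert j I)) \<le> card ((Pow ?T - {{a j, c j}}) \<times> ?B (E - ?T) I)"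
    using fin by (intro card_inj_on_le[OF inj sub]) auto
  also have "\<dots> = 7 * card (?B (E - ?T) I)"
    by (simp only: card_cartesian_product c7)
  finally have "card (?B E (insert j I)) * 8 ^ card (insert j I) \<le> 7 * 8 * (card (?B (E - ?T) I) * 8 ^ card I)"
    using insert.hyps by simp
  also have "\<dots> \<le> 7 * 8 * (7 ^ card I * 2 ^ card (E - ?T))"
    using IH by (intro mult_left_mono) auto
  also have "\<dots> = 7 ^ card (insert j I) * (2 ^ 3 * 2 ^ card (E - ?T))"
    using insert.hyps by simp
  also have "2 ^ 3 * 2 ^ card (E - ?T) = (2 ^ card E :: nat)"
  proof -
    have "card E = 3 + card (E - ?T)"
      using T insert.prems(1) card_mono[OF insert.prems(1) T(2)] by (simp only: card_Diff_subset finite.intros)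
    then show ?thesis by (simp add: power_add)
  qed
  finally show ?case .
qed

text \<open>Union bound over the \<open>48 * d\<close>-subsets, a colouring being encoded as the set
  of pairs it makes true. A subset of size \<open>3 * k\<close> holds \<open>k * k\<close>
  edge-disjoint triangles, so it lacks the pattern for at most a fraction (7/8)^(k*k) of the
  colourings, while there are at most 8^(d*k) such subsets.\<close>

lemma exists_pattern_colouring:
  fixes U :: "nat set"
  assumes "finite U" "card U \<le> 2 ^ d" "d \<ge> 1"
  shows "\<exists>\<phi>. \<forall>A. A \<subseteq> U \<and> card A = 48 * d \<longrightarrow>
      (\<exists>x\<in>A. \<exists>y\<in>A. \<exists>z\<in>A. z < y \<and> y < x \<and> \<phi> x y \<and> \<not> \<phi> x z \<and> \<phi> y z)"
proof -
  \<comment> \<open>16 is the least n with \<open>8 * 7 ^ n < 8 ^ n\<close>; with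
    \<open>k * k = 16 * (d * k)\<close> this inequality closes the union bound.\<close>
  define k where "k = 16 * d"
  let ?E = "U \<times> U"
  define bad where "bad A = {G. G \<subseteq> ?E \<and> \<not> (\<exists>x\<in>A. \<exists>y\<in>A. \<exists>z\<in>A. z < y \<and> y < x \<and>
      (x,y) \<in> G \<and> (x,z) \<notin> G \<and> (y,z) \<in> G)}" for A
  let ?S = "{A. A \<subseteq> U \<and> card A = 3 * k}"
  have fE: "finite ?E" using assms(1) by simp
  have k1: "k \<ge> 1" using assms(3) by (simp add: k_def)
  have bound: "card (bad A) * 8 ^ (k * k) \<le> 7 ^ (k * k) * 2 ^ card ?E" if A: "A \<in> ?S" for A
  proof -
    define f where "f = (!) (sorted_list_of_set A)"
    have finA: "finite A" using A assms(1) finite_subset by auto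
    have len: "length (sorted_list_of_set A) = 3 * k" using A by simp
    have fmem: "f i \<in> A" if "i < 3 * k" for i
      using that len finA unfolding f_def by (metis nth_mem set_sorted_list_of_set)
    have fless: "f i < f j" if "i < j" "j < 3 * k" for i j
      using strict_sorted_list_of_set[of A] that len unfolding f_def by (simp add: sorted_wrt_iff_nth_less)
    have feq: "f i = f j \<longleftrightarrow> i = j" if "i < 3 * k" "j < 3 * k" for i j
      using fless that by (metis less_irrefl linorder_neqE_nat)
    let ?I = "{..<k} \<times> {..<k}"
    txt \<open>The pairs \<open>p = (i, j)\<close> index \<open>k\<^sup>2\<close> triangles with pairwise disjoint edge sets, since any two of
      \<open>i\<close>, \<open>j\<close>, \<open>(i + j) mod k\<close> determine the third.\<close>
    define X where "X p = f (2 * k + (fst p + snd p) mod k)" for p :: "nat \<times> nat"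
    define Y where "Y p = f (k + snd p)" for p :: "nat \<times> nat"
    define Z where "Z p = f (fst p)" for p :: "nat \<times> nat"
    have mem: "X p \<in> A" "Y p \<in> A" "Z p \<in> A" "Z p < Y p" "Y p < X p" if "p \<in> ?I" for p
    proof -
      have "(fst p + snd p) mod k < k" using k1 by simp
      then show "X p \<in> A" "Y p \<in> A" "Z p \<in> A" "Z p < Y p" "Y p < X p"
        using that unfolding X_def Y_def Z_def by (auto intro!: fmem fless)
    qed
    have Yeq: "Y p = Y q \<longleftrightarrow> snd p = snd q" and Zeq: "Z p = Z q \<longleftrightarrow> fst p = fst q"
      and Xeq: "X p = X q \<longleftrightarrow> (fst p + snd p) mod k = (fst q + snd q) mod k"
      and XY: "X p \<noteq> Y q" and XZ: "X p \<noteq> Z q" and YZ: "Y p \<noteq> Z q"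
      if "p \<in> ?I" "q \<in> ?I" for p q
    proof -
      have "(fst p + snd p) mod k < k" "(fst q + snd q) mod k < k" using k1 by auto
      then show "Y p = Y q \<longleftrightarrow> snd p = snd q" "Z p = Z q \<longleftrightarrow> fst p = fst q"
        "X p = X q \<longleftrightarrow> (fst p + snd p) mod k = (fst q + snd q) mod k"
        "X p \<noteq> Y q" "X p \<noteq> Z q" "Y p \<noteq> Z q"
        using that unfolding X_def Y_def Z_def by (auto simp: feq)
    qed
    have modinj: "i = j" if "(i + s) mod k = (j + s) mod k" "i < k" "j < k" for i j s :: nat
    proof -
      have le: "i = j" if "i \<le> j" "(i + s) mod k = (j + s) mod k" "j < k" for i j
        using mod_eq_dvd_iff_nat[of "i + s" "j + s" k] that dvd_imp_le[of k "j - i"] by fastforce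
      show ?thesis using le[of i j] le[of j i] that by linarith
    qed
    have disj: "p = q" if "p \<in> ?I" "q \<in> ?I"
      "{(X p, Y p), (X p, Z p), (Y p, Z p)} \<inter> {(X q, Y q), (X q, Z q), (Y q, Z q)} \<noteq> {}" for p q
    proof -
      have lt: "fst p < k" "snd p < k" "fst q < k" "snd q < k" using that by auto
      \<comment> \<open>\<open>X\<close>, \<open>Y\<close> and \<open>Z\<close> take values in
        disjoint blocks of \<open>A\<close>, so two triangles sharing a pair share two corresponding
        corners.\<close>
      have "(X p = X q \<and> Y p = Y q) \<or> (X p = X q \<and> Z p = Z q) \<or> (Y p = Y q \<and> Z p = Z q)"
        using that(3) XY[OF that(1,2)] XZ[OF that(1,2)] YZ[OF that(1,2)]
          XY[OF that(2,1)] XZ[OF that(2,1)] YZ[OF that(2,1)] by auto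
      then show ?thesis
        unfolding Xeq[OF that(1,2)] Yeq[OF that(1,2)] Zeq[OF that(1,2)]
        using modinj[of "fst p" "snd p" "fst q"] modinj[of "snd p" "fst p" "snd q"] lt
        by (auto simp: prod_eq_iff add.commute)
    qed
    have "card {G. G \<subseteq> ?E \<and> (\<forall>p\<in>?I. \<not> ((X p, Y p) \<in> G \<and> (X p, Z p) \<notin> G \<and> (Y p, Z p) \<in> G))} * 8 ^ card ?I
        \<le> 7 ^ card ?I * 2 ^ card ?E"
    proof (rule card_avoiding)
      show "card {(X p, Y p), (X p, Z p), (Y p, Z p)} = 3" if "p \<in> ?I" for p
        using mem[OF that] by (auto simp: card_insert_if)
      show "{(X p, Y p), (X p, Z p), (Y p, Z p)} \<subseteq> ?E" if "p \<in> ?I" for p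
        using mem[OF that] A by auto
      show "disjoint_family_on (\<lambda>p. {(X p, Y p), (X p, Z p), (Y p, Z p)}) ?I"
        unfolding disjoint_family_on_def
      proof (intro ballI impI, rule ccontr)
        fix p q assume pq: "p \<in> ?I" "q \<in> ?I" "p \<noteq> q"
          and "{(X p, Y p), (X p, Z p), (Y p, Z p)} \<inter> {(X q, Y q), (X q, Z q), (Y q, Z q)} \<noteq> {}"
        from disj[OF pq(1,2) this(4)] pq(3) show False by simp
      qed
    qed (use fE in auto)
    moreover have "card (bad A) \<le> card {G. G \<subseteq> ?E \<and> (\<forall>p\<in>?I. \<not> ((X p, Y p) \<in> G \<and> (X p, Z p) \<notin> G \<and> (Y p, Z p) \<in> G))}"
    proof (rule card_mono)
      show "bad A \<subseteq> {G. G \<subseteq> ?E \<and> (\<forall>p\<in>?I. \<not> ((X p, Y p) \<in> G \<and> (X p, Z p) \<notin> G \<and> (Y p, Z p) \<in> G))}"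
      proof (rule subsetI, rule CollectI, intro conjI ballI notI)
        fix G assume G: "G \<in> bad A"
        then show "G \<subseteq> ?E" by (simp add: bad_def)
        fix p assume p: "p \<in> ?I" and "(X p, Y p) \<in> G \<and> (X p, Z p) \<notin> G \<and> (Y p, Z p) \<in> G"
        with mem[OF p] have "\<exists>x\<in>A. \<exists>y\<in>A. \<exists>z\<in>A. z < y \<and> y < x \<and> (x,y) \<in> G \<and> (x,z) \<notin> G \<and> (y,z) \<in> G"
          by (intro bexI[of _ "X p"] bexI[of _ "Y p"] bexI[of _ "Z p"]) simp_all
        then show False using G unfolding bad_def mem_Collect_eq by argo
      qed
    qed (use fE in simp)
    ultimately show ?thesis
      by (simp add: card_cartesian_product) (meson le_trans mult_le_mono1)
  qed
  have fS: "finite ?S" using assms(1) by simp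
  have "card (\<Union>A\<in>?S. bad A) < 2 ^ card ?E"
  proof (cases "3 * k \<le> card U")
    case True
    have kk: "k * k = 16 * (d * k)" by (simp add: k_def)
    have "card ?S = card U choose (3 * k)" using n_subsets[OF assms(1)] by simp
    also have "\<dots> \<le> card U ^ (3 * k)" using True by (rule binomial_le_pow)
    also have "\<dots> \<le> (2 ^ d) ^ (3 * k)" using assms(2) by (rule power_mono) simp
    also have "\<dots> = (2 ^ 3) ^ (d * k)" by (simp only: power_mult[symmetric] mult_ac)
    also have "\<dots> = 8 ^ (d * k)" by simp
    finally have cS: "card ?S \<le> 8 ^ (d * k)" .
    have "card (\<Union>A\<in>?S. bad A) \<le> (\<Sum>A\<in>?S. card (bad A))" using fS by (rule card_UN_le)
    then have "card (\<Union>A\<in>?S. bad A) * 8 ^ (k * k) \<le> (\<Sum>A\<in>?S. card (bad A) * 8 ^ (k * k))"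
      by (simp flip: sum_distrib_right)
    also have "\<dots> \<le> card ?S * (7 ^ (k * k) * 2 ^ card ?E)"
      using sum_bounded_above[of ?S "\<lambda>A. card (bad A) * 8 ^ (k * k)", OF bound] by simp
    also have "\<dots> \<le> 8 ^ (d * k) * (7 ^ (k * k) * 2 ^ card ?E)"
      using cS by (rule mult_le_mono1)
    also have "\<dots> = (8 * 7 ^ 16) ^ (d * k) * 2 ^ card ?E"
      by (simp only: kk power_mult[of _ 16 "d * k"] power_mult_distrib mult.assoc)
    also have "\<dots> < (8 ^ 16) ^ (d * k) * 2 ^ card ?E"
      using assms(3) k1 by (intro mult_strict_right_mono power_strict_mono) auto
    also have "(8 ^ 16) ^ (d * k) = (8 ^ (k * k) :: nat)"
      by (simp only: kk power_mult[of _ 16 "d * k"])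
    finally show ?thesis by simp
  next
    case False
    then have "A \<notin> ?S" for A using card_mono[OF assms(1), of A] by auto
    then have "?S = {}" by blast
    then show ?thesis by (simp only: UN_empty) simp
  qed
  also have "\<dots> = card (Pow ?E)" using fE by (simp add: card_Pow)
  finally have "\<not> Pow ?E \<subseteq> (\<Union>A\<in>?S. bad A)"
    using fS fE by (metis (no_types, lifting) bad_def card_mono finite_UN finite_Collect_subsets
       leD rev_finite_subset mem_Collect_eq subsetI finite_Pow_iff Pow_iff)
  then obtain G where G: "G \<subseteq> ?E" "\<And>A. A \<in> ?S \<Longrightarrow> G \<notin> bad A" by blast
  show ?thesis
  proof (intro exI[of _ "\<lambda>x y. (x, y) \<in> G"] allI impI)
    fix A assume "A \<subseteq> U \<and> card A = 48 * d"
    then have "G \<notin> bad A" by (intro G) (simp add: k_def)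
    then show "\<exists>x\<in>A. \<exists>y\<in>A. \<exists>z\<in>A. z < y \<and> y < x \<and> (x,y) \<in> G \<and> (x,z) \<notin> G \<and> (y,z) \<in> G"
      using G(1) unfolding bad_def by blast
  qed
qed

section \<open>Edge conditions on levels and the exclusion of six-cliques\<close>

text \<open>The arguments are the levels between consecutive vertices of a quadruple. The disjuncts are the
  path turning right twice, the path turning left twice, the balanced tree, and the path turning right
  and then left; a quadruple whose path turns left and then right is never an edge.\<close>

definition level_edge :: "(nat \<Rightarrow> nat \<Rightarrow> bool) \<Rightarrow> nat \<Rightarrow> nat \<Rightarrow> nat \<Rightarrow> bool" where
  "level_edge \<phi> a b c \<longleftrightarrow>
     a > b \<and> b > c \<and> \<phi> a b \<and> \<not> \<phi> a c \<and> \<phi> b c \<or>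
     a < b \<and> b < c \<and> \<phi> c b \<and> \<not> \<phi> c a \<and> \<phi> b a \<or>
     a < b \<and> c < b \<and> (\<phi> b a \<or> \<not> \<phi> b c) \<or>
     b < c \<and> c < a \<and> \<phi> a c \<and> \<phi> a b \<and> \<not> \<phi> c b"

lemma level_edge_order:
  assumes "level_edge \<phi> a b c"
  obtains "a > b" "b > c" | "a < b" "b < c" | "a < b" "c < b" | "b < c" "c < a"
  using assms unfolding level_edge_def by blast

lemma level_edge_dec: "a > b \<Longrightarrow> b > c \<Longrightarrow> level_edge \<phi> a b c \<longleftrightarrow> \<phi> a b \<and> \<not> \<phi> a c \<and> \<phi> b c"
  and level_edge_inc: "a < b \<Longrightarrow> b < c \<Longrightarrow> level_edge \<phi> a b c \<longleftrightarrow> \<phi> c b \<and> \<not> \<phi> c a \<and> \<phi> b a"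
  and level_edge_peak: "a < b \<Longrightarrow> c < b \<Longrightarrow> level_edge \<phi> a b c \<longleftrightarrow> \<phi> b a \<or> \<not> \<phi> b c"
  and level_edge_valley: "b < c \<Longrightarrow> c < a \<Longrightarrow> level_edge \<phi> a b c \<longleftrightarrow> \<phi> a c \<and> \<phi> a b \<and> \<not> \<phi> c b"
  and level_edge_valley': "a > b \<Longrightarrow> a \<le> c \<Longrightarrow> \<not> level_edge \<phi> a b c"
  unfolding level_edge_def by auto

lemmas level_edge_simps = level_edge_dec level_edge_inc level_edge_peak level_edge_valley level_edge_valley'

text \<open>The hypotheses are the five quadruples of five increasing vertices with consecutive
  levels \<open>a\<close>, \<open>b\<close>, \<open>c\<close>, \<open>d\<close>: skipping an inner
  vertex replaces the two levels beside it by their maximum, as in \<open>\<delta>_max\<close>.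
  Comparing the shapes of the first and last quadruple leaves four orders.\<close>

lemma clique5_levels:
  assumes
   "level_edge \<phi> a b c" "level_edge \<phi> a b (max c d)" "level_edge \<phi> a (max b c) d" "level_edge \<phi> (max a b) c d" "level_edge \<phi> b c d"
 obtains "a < b" "b < c" "d < c" | "a < b" "c < b" "d < c" | "a < b" "c < d" "d < b" | "b < c" "c < a" "d < c"
proof -
  have "a < b \<and> b < c \<and> d < c \<or> a < b \<and> c < b \<and> d < c \<or> a < b \<and> c < d \<and> d < b \<or> b < c \<and> c < a \<and> d < c"
  proof (rule level_edge_order[OF assms(1)]; rule level_edge_order[OF assms(5)])
  qed (use assms in \<open>auto simp: level_edge_simps max_def split: if_splits\<close>)
  then show ?thesis using that by blast
qed

text \<open>Only five orders fit \<open>clique5_levels\<close> on both the first and the last five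
  vertices. In each of them a balanced quadruple forces \<open>\<not> \<phi>\<close> on a pair of
  levels where a right-right or right-left path demands \<open>\<phi>\<close>.\<close>

lemma no_clique6_levels:
  fixes a b c d e :: nat
  assumes
   "level_edge \<phi> a b c" "level_edge \<phi> a b (max c d)"
   "level_edge \<phi> a (max b c) d" "level_edge \<phi> a (max b c) (max d e)"
   "level_edge \<phi> (max a b) c d"
   "level_edge \<phi> (max a (max b c)) d e"
   "level_edge \<phi> b c d" "level_edge \<phi> b c (max d e)" "level_edge \<phi> b (max c d) e" "level_edge \<phi> (max b c) d e" "level_edge \<phi> c d e"
  shows False
  by (rule clique5_levels[OF assms(1,2,3,5,7)]; rule clique5_levels[OF assms(7-11)])
    (use assms in \<open>auto simp: level_edge_simps max_def split: if_splits\<close>)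


section \<open>Branching levels in the binary trie\<close>

text \<open>\<open>x div 2 ^ t\<close> is the ancestor of the leaf \<open>x\<close> at height
  \<open>t\<close>. For distinct leaves this level is one more than the position of the highest bit
  in which they differ; for equal leaves it is 0.\<close>

definition \<delta> :: "nat \<Rightarrow> nat \<Rightarrow> nat" where
  "\<delta> x y = (LEAST t. x div 2 ^ t = y div 2 ^ t)"

lemma div_eq_mono: "(x::nat) div 2 ^ s = y div 2 ^ s \<Longrightarrow> s \<le> t \<Longrightarrow> x div 2 ^ t = y div 2 ^ t"
  by (metis div_mult2_eq le_add_diff_inverse power_add)

lemma \<delta>_le_iff: "\<delta> x y \<le> t \<longleftrightarrow> x div 2 ^ t = y div 2 ^ t"
proof
  \<comment> \<open>At height \<open>x + y\<close> both quotients are 0, so \<open>LEAST\<close>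
    ranges over a nonempty set.\<close>
  have "x div 2 ^ (x + y) = y div 2 ^ (x + y)"
  proof -
    have "x < 2 ^ (x + y)" "y < 2 ^ (x + y)"
      by (meson le_add1 le_add2 le_less_trans less_exp order_le_less_trans)+
    then show ?thesis by simp
  qed
  then have "x div 2 ^ \<delta> x y = y div 2 ^ \<delta> x y"
    unfolding \<delta>_def by (rule LeastI)
  then show "x div 2 ^ t = y div 2 ^ t" if "\<delta> x y \<le> t"
    using that by (rule div_eq_mono)
qed (simp add: \<delta>_def Least_le)

text \<open>Ancestors at a fixed height are monotone in the leaf, so a common ancestor of
  \<open>x\<close> and \<open>z\<close> is also one of \<open>y\<close>, which lies between
  them.\<close>

lemma \<delta>_max:
  assumes "x < y" "y < z"
  shows "\<delta> x z = max (\<delta> x y) (\<delta> y z)"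
proof -
  have "x div 2 ^ t \<le> y div 2 ^ t" "y div 2 ^ t \<le> z div 2 ^ t" for t
    using assms by (auto intro: div_le_mono)
  then have "\<delta> x z \<le> t \<longleftrightarrow> max (\<delta> x y) (\<delta> y z) \<le> t" for t
    unfolding max.bounded_iff \<delta>_le_iff by (metis order_antisym_conv)
  then show ?thesis by (meson order_antisym order_refl)
qed

text \<open>Here the trie being binary matters: with equal levels, the ancestors one height below
  would be three distinct children of one node.\<close>

lemma \<delta>_neq:
  assumes "x < y" "y < z"
  shows "\<delta> x y \<noteq> \<delta> y z"
proof
  assume eq: "\<delta> x y = \<delta> y z"
  have "\<delta> x y \<noteq> 0" using \<delta>_le_iff[of x y 0] assms by auto
  then obtain s where s: "\<delta> x y = Suc s" by (cases "\<delta> x y") auto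
  have "x div 2 ^ s \<noteq> y div 2 ^ s" "y div 2 ^ s \<noteq> z div 2 ^ s"
    using \<delta>_le_iff[of x y s] \<delta>_le_iff[of y z s] s eq by auto
  moreover have "x div 2 ^ s \<le> y div 2 ^ s" "y div 2 ^ s \<le> z div 2 ^ s"
    using assms by (auto intro: div_le_mono)
  ultimately have "x div 2 ^ s + 2 \<le> z div 2 ^ s" by linarith
  moreover have "x div 2 ^ s div 2 = z div 2 ^ s div 2"
    using \<delta>_le_iff[of x y "Suc s"] \<delta>_le_iff[of y z "Suc s"] s eq
    by (simp add: div_mult2_eq power_Suc2 del: power_Suc)
  ultimately show False by linarith
qed

lemma \<delta>_le: "x < 2 ^ D \<Longrightarrow> y < 2 ^ D \<Longrightarrow> \<delta> x y \<le> D"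
  by (simp add: \<delta>_le_iff)

lemma \<delta>_pos: "x < y \<Longrightarrow> \<delta> x y \<ge> 1"
  using \<delta>_le_iff[of x y 0] by (simp add: Suc_le_eq)

section \<open>Top branchings and the levels along a path\<close>

definition split_at :: "nat set \<Rightarrow> nat set \<Rightarrow> nat set \<Rightarrow> nat \<Rightarrow> bool" where
  "split_at T A B t \<longleftrightarrow> T = A \<union> B \<and> A \<noteq> {} \<and> B \<noteq> {} \<and> (\<forall>a\<in>A. \<forall>b\<in>B. a < b \<and> \<delta> a b = t) \<and>
     (\<forall>x\<in>A. \<forall>y\<in>A. x < y \<longrightarrow> \<delta> x y < t) \<and> (\<forall>x\<in>B. \<forall>y\<in>B. x < y \<longrightarrow> \<delta> x y < t)"

lemma exists_split:
  assumes "finite T" "card T \<ge> 2"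
  obtains A B t where "split_at T A B t"
proof -
  define l r t where "l = Min T" and "r = Max T" and "t = \<delta> l r"
  have ne: "T \<noteq> {}" using assms by auto
  have mem: "l \<in> T" "r \<in> T" and bnd: "\<And>x. x \<in> T \<Longrightarrow> l \<le> x \<and> x \<le> r"
    using assms(1) ne by (auto simp: l_def r_def)
  have lr: "l < r"
  proof (rule ccontr)
    assume "\<not> l < r"
    then have "T \<subseteq> {l}" using bnd by fastforce
    then show False using card_mono[of "{l}" T] assms by simp
  qed
  define A where "A = {x \<in> T. x = l \<or> \<delta> l x < t}"
  define B where "B = T - A"
  \<comment> \<open>All levels are compared through the two extreme leaves: for an inner leaf
    exactly one of its levels to \<open>l\<close> and \<open>r\<close> equals \<open>t\<close>,
    which decides its side.\<close>
  have tmax: "t = max (\<delta> l x) (\<delta> x r)" "\<delta> l x \<noteq> \<delta> x r" if "l < x" "x < r" for x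
    using \<delta>_max[OF that] \<delta>_neq[OF that] by (simp_all add: t_def)
  have xr: "\<delta> x r = t" if "x \<in> A" for x
  proof (cases "x = l")
    case False
    then have *: "\<delta> l x < t" "l < x" using that bnd[of x] by (auto simp: A_def)
    then have "x < r" using that bnd[of x] by (cases "x = r") (auto simp: A_def t_def)
    then show ?thesis using tmax(1)[of x] * by linarith
  qed (simp add: t_def)
  have lB: "\<delta> l x = t \<and> l < x" if "x \<in> B" for x
  proof (cases "x = r")
    case False
    then have *: "l < x" "x < r" "\<not> \<delta> l x < t" using that bnd[of x] by (auto simp: A_def B_def)
    then show ?thesis using tmax(1)[of x] by linarith
  qed (simp add: t_def lr)
  have Ar: "x < r" if "x \<in> A" for x
    using that bnd[of x] lr by (cases "x = r") (auto simp: A_def t_def)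
  have Br: "\<delta> x r < t" if "x \<in> B" "x < r" for x
    using lB[OF that(1)] tmax[of x] that by linarith
  have AB: "a < b" if "a \<in> A" "b \<in> B" for a b
  proof (rule ccontr)
    assume "\<not> a < b"
    moreover have "a \<noteq> b" using that by (auto simp: B_def)
    ultimately have "b < a" by simp
    then have "\<delta> l a \<ge> t" using lB[OF that(2)] \<delta>_max[of l b a] by simp
    then show False using that lB[OF that(2)] \<open>b < a\<close> by (auto simp: A_def)
  qed
  have "split_at T A B t"
    unfolding split_at_def
  proof (intro conjI ballI impI)
    show "T = A \<union> B" by (auto simp: A_def B_def)
    show "A \<noteq> {}" using mem by (auto simp: A_def)
    show "B \<noteq> {}" using mem Ar by (auto simp: B_def)
    fix a b assume ab: "a \<in> A" "b \<in> B"
    then show "a < b" by (rule AB)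
    show "\<delta> a b = t"
      using ab AB[OF ab] lB[OF ab(2)] xr[OF ab(1)] Br[OF ab(2)] \<delta>_max[of a b r] bnd[of b]
      by (cases "b = r") (auto simp: B_def max_def split: if_splits)
  next
    fix x y assume "x \<in> A" "y \<in> A" "x < y"
    then show "\<delta> x y < t" using bnd[of x] \<delta>_max[of l x y]
      by (cases "x = l") (auto simp: A_def)
  next
    fix x y assume "x \<in> B" "y \<in> B" "x < y"
    then show "\<delta> x y < t" using Br[of x] bnd[of y] \<delta>_max[of x y r]
      by (cases "y = r") (auto simp: B_def)
  qed
  then show ?thesis by (rule that)
qed

text \<open>The heights on the path from the root to \<open>w\<close> where leaves of
  \<open>S\<close> branch off to the left, that is, where the path turns right;
  \<open>levels_above\<close> records its left turns.\<close>

definition levels_below :: "nat set \<Rightarrow> nat \<Rightarrow> nat set" where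
  "levels_below S w = (\<lambda>v. \<delta> v w) ` {v \<in> S. v < w}"

definition levels_above :: "nat set \<Rightarrow> nat \<Rightarrow> nat set" where
  "levels_above S w = (\<lambda>v. \<delta> w v) ` {v \<in> S. w < v}"

text \<open>Descend from the root, always leaving a side with at most \<open>K\<close> leaves, until
  one leaf \<open>w\<close> remains. Each side left behind adds one new level to the path of
  \<open>w\<close>, since all levels inside the other side are smaller than
  \<open>t\<close>.\<close>

lemma card_le_levels:
  assumes "finite S" "S \<noteq> {}"
    and "\<And>T A B t. T \<subseteq> S \<Longrightarrow> split_at T A B t \<Longrightarrow> card A \<le> K \<or> card B \<le> K"
  shows "\<exists>w\<in>S. card S \<le> 1 + K * (card (levels_below S w) + card (levels_above S w))"
  using assms
proof (induction "card S" arbitrary: S rule: less_induct)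
  case less
  show ?case
  proof (cases "card S \<ge> 2")
    case False
    then show ?thesis using less.prems(2) by fastforce
  next
    case True
    then obtain A B t where sp: "split_at S A B t" using exists_split less.prems(1) by blast
    have S: "S = A \<union> B" and ne: "A \<noteq> {}" "B \<noteq> {}" and lt: "\<And>a b. a \<in> A \<Longrightarrow> b \<in> B \<Longrightarrow> a < b \<and> \<delta> a b = t"
      and inA: "\<And>x y. x \<in> A \<Longrightarrow> y \<in> A \<Longrightarrow> x < y \<Longrightarrow> \<delta> x y < t"
      and inB: "\<And>x y. x \<in> B \<Longrightarrow> y \<in> B \<Longrightarrow> x < y \<Longrightarrow> \<delta> x y < t"
      using sp unfolding split_at_def by blast+
    have fin: "finite A" "finite B" using S less.prems(1) by auto
    have cS: "card S = card A + card B"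
      unfolding S using lt by (intro card_Un_disjoint fin) blast
    have pos: "card A > 0" "card B > 0" using ne fin by (auto simp: card_gt_0_iff)
    from less.prems(3)[OF order_refl sp] consider "card A \<le> K" | "card B \<le> K" by blast
    then show ?thesis
    proof cases
      case 1
      obtain w where w: "w \<in> B" "card B \<le> 1 + K * (card (levels_below B w) + card (levels_above B w))"
        using less.hyps[of B] less.prems(3) cS pos ne fin S by (metis Un_upper2 less_add_same_cancel2 subset_trans)
      have "{v \<in> S. v < w} = A \<union> {v \<in> B. v < w}" "{v \<in> S. w < v} = {v \<in> B. w < v}"
        using lt[OF _ w(1)] unfolding S by force+
      moreover have "(\<lambda>v. \<delta> v w) ` A = {t}" using lt[OF _ w(1)] ne(1) by auto
      ultimately have "levels_below S w = insert t (levels_below B w)" "levels_above S w = levels_above B w"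
        unfolding levels_below_def levels_above_def by (simp_all add: image_Un)
      moreover have "t \<notin> levels_below B w" "finite (levels_below B w)"
        using inB w(1) fin unfolding levels_below_def by force+
      ultimately have "card S \<le> 1 + K * (card (levels_below S w) + card (levels_above S w))"
        using w(2) 1 cS by simp
      then show ?thesis using w(1) S by blast
    next
      case 2
      obtain w where w: "w \<in> A" "card A \<le> 1 + K * (card (levels_below A w) + card (levels_above A w))"
        using less.hyps[of A] less.prems(3) cS pos ne fin S by (metis Un_upper1 less_add_same_cancel1 subset_trans)
      have "{v \<in> S. w < v} = {v \<in> A. w < v} \<union> B" "{v \<in> S. v < w} = {v \<in> A. v < w}"
        using lt[OF w(1)] unfolding S by force+
      moreover have "(\<lambda>v. \<delta> w v) ` B = {t}" using lt[OF w(1)] ne(2) by auto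
      ultimately have "levels_above S w = insert t (levels_above A w)" "levels_below S w = levels_below A w"
        unfolding levels_below_def levels_above_def by (simp_all add: image_Un)
      moreover have "t \<notin> levels_above A w" "finite (levels_above A w)"
        using inA w(1) fin unfolding levels_above_def by force+
      ultimately have "card S \<le> 1 + K * (card (levels_below S w) + card (levels_above S w))"
        using w(2) 2 cS by simp
      then show ?thesis using w(1) S by blast
    qed
  qed
qed

section \<open>Edges, sparse sets and cliques\<close>

definition edge :: "(nat \<Rightarrow> nat \<Rightarrow> bool) \<Rightarrow> nat set \<Rightarrow> bool" where
  "edge \<phi> e \<longleftrightarrow> (\<exists>p q r s. p < q \<and> q < r \<and> r < s \<and> e = {p, q, r, s} \<and> level_edge \<phi> (\<delta> p q) (\<delta> q r) (\<delta> r s))"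

lemma edgeI: "p < q \<Longrightarrow> q < r \<Longrightarrow> r < s \<Longrightarrow> level_edge \<phi> (\<delta> p q) (\<delta> q r) (\<delta> r s) \<Longrightarrow> edge \<phi> {p, q, r, s}"
  unfolding edge_def by blast

lemma edgeD:
  assumes "edge \<phi> {p, q, r, s}" "p < q" "q < r" "r < s"
  shows "level_edge \<phi> (\<delta> p q) (\<delta> q r) (\<delta> r s)"
proof -
  obtain p' q' r' s' where *: "p' < q'" "q' < r'" "r' < s'" "{p, q, r, s} = {p', q', r', s'}"
    and E: "level_edge \<phi> (\<delta> p' q') (\<delta> q' r') (\<delta> r' s')"
    using assms(1) unfolding edge_def by blast
  have "[p, q, r, s] = [p', q', r', s']"
    using assms * by (intro strict_sorted_equal) auto
  then show ?thesis using E by simp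
qed

lemma card_edge: "edge \<phi> e \<Longrightarrow> card e = 4"
  unfolding edge_def by auto

text \<open>Distinct edges have a union of size 5 exactly if they form a copy of the two-edge 4-graph.\<close>

definition sparse :: "(nat \<Rightarrow> nat \<Rightarrow> bool) \<Rightarrow> nat set \<Rightarrow> bool" where
  "sparse \<phi> S \<longleftrightarrow> (\<forall>e f. edge \<phi> e \<and> edge \<phi> f \<and> e \<union> f \<subseteq> S \<longrightarrow> card (e \<union> f) \<noteq> 5)"

lemma sparseD: "sparse \<phi> S \<Longrightarrow> edge \<phi> e \<Longrightarrow> edge \<phi> f \<Longrightarrow> e \<union> f \<subseteq> S \<Longrightarrow> card (e \<union> f) = 5 \<Longrightarrow> False"
  unfolding sparse_def by blast

lemma no_clique:
  assumes "card X = 6" "\<And>e. e \<subseteq> X \<Longrightarrow> card e = 4 \<Longrightarrow> edge \<phi> e"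
  shows False
proof -
  define v where "v i = sorted_list_of_set X ! i" for i
  have fin: "finite X" using assms(1) by (metis card.infinite zero_neq_numeral)
  have len: "length (sorted_list_of_set X) = 6" using assms(1) by simp
  have mem: "v i \<in> X" if "i < 6" for i
    using that len fin unfolding v_def by (metis nth_mem set_sorted_list_of_set)
  have less: "v i < v j" if "i < j" "j < 6" for i j
    using strict_sorted_list_of_set[of X] that len unfolding v_def by (simp add: sorted_wrt_iff_nth_less)
  have E: "level_edge \<phi> (\<delta> (v i) (v j)) (\<delta> (v j) (v k)) (\<delta> (v k) (v l))" if "i < j" "j < k" "k < l" "l < 6" for i j k l
  proof -
    have lt: "v i < v j" "v j < v k" "v k < v l" using that by (auto intro: less)
    have "edge \<phi> {v i, v j, v k, v l}"
      using lt mem that by (intro assms(2)) auto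
    then show ?thesis using lt by (rule edgeD)
  qed
  have d2: "\<delta> (v i) (v (i + 2)) = max (\<delta> (v i) (v (i + 1))) (\<delta> (v (i + 1)) (v (i + 2)))" if "i + 2 < 6" for i
    using that by (intro \<delta>_max less) auto
  have d3: "\<delta> (v i) (v (i + 3)) = max (\<delta> (v i) (v (i + 1))) (max (\<delta> (v (i + 1)) (v (i + 2))) (\<delta> (v (i + 2)) (v (i + 3))))"
    if "i + 3 < 6" for i
    using that \<delta>_max[of "v i" "v (i + 1)" "v (i + 3)"] d2[of "i + 1"] less by (simp add: numeral_eq_Suc)
  note D = d2[of 0] d2[of 1] d2[of 2] d2[of 3] d3[of 0]
  show False
    by (rule no_clique6_levels[of \<phi> "\<delta> (v 0) (v 1)" "\<delta> (v 1) (v 2)" "\<delta> (v 2) (v 3)" "\<delta> (v 3) (v 4)" "\<delta> (v 4) (v 5)"])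
      (use E[of 0 1 2 3] E[of 0 1 2 4] E[of 0 1 3 4] E[of 0 1 3 5] E[of 0 2 3 4] E[of 0 3 4 5]
         E[of 1 2 3 4] E[of 1 2 3 5] E[of 1 2 4 5] E[of 1 3 4 5] E[of 2 3 4 5] D in \<open>simp_all add: numeral_eq_Suc\<close>)
qed

section \<open>The size of a sparse set\<close>

text \<open>Of three leaves, one branches off from the other two at a single level. Adding the same
  two vertices, suitably placed, to both pairs gives quadruples with the same levels, hence two
  edges on five vertices as soon as one of them is an edge.\<close>

lemma exists_level_pairs:
  assumes "finite A" "card A \<ge> 3"
  obtains z p q p' q' where "{p, q, p', q'} \<subseteq> A" "card {p, q, p', q'} = 3" "p < q" "p' < q'"
    "\<delta> p q = z" "\<delta> p' q' = z"
proof -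
  obtain T where T: "T \<subseteq> A" "card T = 3" using assms(2) by (rule obtain_subset_with_card_n) blast
  then have fin: "finite T" using assms(1) finite_subset by blast
  define u where "u i = sorted_list_of_set T ! i" for i
  have len: "length (sorted_list_of_set T) = 3" using T by simp
  have mem: "u i \<in> A" if "i < 3" for i
    using that len fin T(1) unfolding u_def by (metis nth_mem set_sorted_list_of_set subsetD)
  have less: "u 0 < u 1" "u 1 < u 2"
    using strict_sorted_list_of_set[of T] len unfolding u_def by (simp_all add: sorted_wrt_iff_nth_less)
  consider "\<delta> (u 0) (u 1) = \<delta> (u 0) (u 2)" | "\<delta> (u 1) (u 2) = \<delta> (u 0) (u 2)"
    using \<delta>_max[OF less] by linarith
  then show ?thesis
  proof cases
    case 1
    then show ?thesis
      using that[of "u 0" "u 1" "u 0" "u 2"] less mem by (auto simp: card_insert_if)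
  next
    case 2
    then show ?thesis
      using that[of "u 1" "u 2" "u 0" "u 2"] less mem by (auto simp: card_insert_if)
  qed
qed

text \<open>If both sides were larger, sparseness would force \<open>\<phi> t z\<close>,
  \<open>\<phi> t y\<close> and \<open>\<not> \<phi> y z\<close>, where \<open>z\<close> is the
  level of two pairs inside \<open>L\<close>. These are exactly the conditions making right-left
  paths with levels \<open>t\<close>, \<open>z\<close>, \<open>y\<close> edges.\<close>

lemma sparse_split_right:
  assumes sp: "sparse \<phi> S" and S: "A \<union> T \<subseteq> S"
    and u: "u \<in> A" "u' \<in> A" "u < u'" "\<delta> u u' < t"
    and AT: "\<And>a b. a \<in> A \<Longrightarrow> b \<in> T \<Longrightarrow> a < b \<and> \<delta> a b = t"
    and T: "\<And>x y. x \<in> T \<Longrightarrow> y \<in> T \<Longrightarrow> x < y \<Longrightarrow> \<delta> x y < t"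
    and spl: "split_at T L R y" and fin: "finite L" "finite R"
  shows "card L \<le> 2 \<or> card R \<le> 1"
proof (rule ccontr)
  assume "\<not> ?thesis"
  then have card: "card L \<ge> 3" "card R \<ge> 2" by auto
  have TLR: "T = L \<union> R" and LR: "\<And>a b. a \<in> L \<Longrightarrow> b \<in> R \<Longrightarrow> a < b \<and> \<delta> a b = y"
    and inL: "\<And>x z. x \<in> L \<Longrightarrow> z \<in> L \<Longrightarrow> x < z \<Longrightarrow> \<delta> x z < y"
    and inR: "\<And>x z. x \<in> R \<Longrightarrow> z \<in> R \<Longrightarrow> x < z \<Longrightarrow> \<delta> x z < y"
    using spl unfolding split_at_def by blast+
  obtain z p q p' q' where pq: "{p, q, p', q'} \<subseteq> L" and c3: "card {p, q, p', q'} = 3"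
    and lt: "p < q" "p' < q'" and z: "\<delta> p q = z" "\<delta> p' q' = z"
    using exists_level_pairs[OF fin(1) card(1)] by metis
  obtain r s where rs: "r \<in> R" "s \<in> R" "r < s"
  proof -
    have "R \<noteq> {}" using card(2) by auto
    then have "Min R \<in> R" "Max R \<in> R" using fin by auto
    moreover have "Min R \<noteq> Max R"
    proof
      assume "Min R = Max R"
      then have "R \<subseteq> {Min R}" using fin by (metis Max_ge Min_le order_antisym singleton_iff subsetI)
      then show False using card(2) card_mono[of "{Min R}" R] by simp
    qed
    ultimately show ?thesis using that fin by (metis Max_ge order_less_le)
  qed
  have zy: "z < y" using inL[of p q] pq lt z by auto
  have yt: "y < t" using T[of p r] LR[of p r] pq rs TLR by auto
  have mem: "p \<in> T" "q \<in> T" "p' \<in> T" "q' \<in> T" "r \<in> T" "s \<in> T" using pq rs TLR by auto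
  have rs_lt: "\<delta> r s < y" using inR rs by simp
  have ineq: "u < p" "u' < p" "u < p'" "u' < p'" "u < r" "u' < r"
    using AT u mem by auto
  have ineq2: "p < r" "q < r" "p' < r" "q' < r" using LR pq rs by auto
  have eqs: "\<delta> u p = t" "\<delta> u' p = t" "\<delta> u p' = t" "\<delta> u' p' = t" "\<delta> u r = t" "\<delta> u' r = t"
    "\<delta> p r = y" "\<delta> q r = y" "\<delta> p' r = y" "\<delta> q' r = y" "\<delta> p s = y" "\<delta> q s = y"
    using AT u mem LR pq rs by auto
  have notL: "x \<notin> L" if "x \<in> A \<union> R" for x
    using that AT[of x x] LR[of x x] TLR by blast
  have disjL: "{x, x'} \<inter> {p, q, p', q'} = {}" if "x \<in> A \<union> R" "x' \<in> A \<union> R" for x x'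
    using notL[OF that(1)] notL[OF that(2)] pq by blast
  have c5: "card ({x, x'} \<union> {p, q, p', q'}) = 5" if "x \<in> A \<union> R" "x' \<in> A \<union> R" "x \<noteq> x'" for x x'
    using disjL[OF that(1,2)] c3 that(3) by (subst card_Un_disjoint) auto
  have SS: "A \<subseteq> S" "T \<subseteq> S" using S by auto
  \<comment> \<open>Two edges that differ only in which of the two pairs of level \<open>z\<close>
    they use span five vertices.\<close>
  have two: False if "edge \<phi> e" "edge \<phi> f" "e \<union> f = {x, x'} \<union> {p, q, p', q'}"
    "x \<in> A \<union> R" "x' \<in> A \<union> R" "x \<noteq> x'" for e f x x'
    using sparseD[OF sp that(1,2)] c5[OF that(4-6)] that(3-5) SS mem TLR by auto
  have tz: "\<phi> t z"
  proof (rule ccontr)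
    assume "\<not> \<phi> t z"
    then have "edge \<phi> {u, u', p, q}" "edge \<phi> {u, u', p', q'}"
      using u ineq lt zy yt by (auto intro!: edgeI simp: eqs z level_edge_peak)
    then show False by (rule two[of _ _ u u']) (use u in auto)
  qed
  \<comment> \<open>The pairs \<open>p\<close>, \<open>r\<close> and \<open>p\<close>,
    \<open>s\<close> both have level \<open>y\<close> and share \<open>p\<close>, so they take over
    the role of the two pairs in \<open>L\<close>.\<close>
  have ty: "\<phi> t y"
  proof (rule ccontr)
    assume *: "\<not> \<phi> t y"
    have "edge \<phi> {u, u', p, r}" "edge \<phi> {u, u', p, s}"
      using * u ineq ineq2 rs yt by (auto intro!: edgeI simp: eqs level_edge_peak)
    moreover have "card ({u, u', p, r} \<union> {u, u', p, s}) = 5"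
      using u ineq ineq2 rs by (auto simp: card_insert_if)
    moreover have "{u, u', p, r} \<union> {u, u', p, s} \<subseteq> S" using u mem SS by auto
    ultimately show False using sparseD[OF sp] by blast
  qed
  have yz: "\<not> \<phi> y z"
  proof
    assume "\<phi> y z"
    then have "edge \<phi> {p, q, r, s}" "edge \<phi> {p', q', r, s}"
      using ineq2 rs lt zy rs_lt by (auto intro!: edgeI simp: eqs z level_edge_peak)
    then show False by (rule two[of _ _ r s]) (use rs in auto)
  qed
  \<comment> \<open>The zigzag: right at \<open>t\<close>, left at \<open>y\<close>, then the
    branching at \<open>z\<close>.\<close>
  have "edge \<phi> {u, p, q, r}" "edge \<phi> {u, p', q', r}"
    using ineq ineq2 lt zy yt tz ty yz by (auto intro!: edgeI simp: eqs z level_edge_valley)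
  then show False
    by (rule two[of _ _ u r]) (use u rs ineq in auto)
qed

text \<open>The smallest level \<open>t\<close> is set aside and the pattern is found among
  \<open>m\<close> others. The leaves \<open>a\<close>, \<open>b\<close>, \<open>c\<close> at its
  three levels then form an edge both with \<open>w\<close> and with the leaf \<open>d\<close> at
  level \<open>t\<close>, since below the third level the last vertex can be either.\<close>

lemma card_levels_below:
  assumes sp: "sparse \<phi> S" and fin: "finite S" and S: "S \<subseteq> {..<2 ^ D}" and w: "w \<in> S"
    and \<phi>: "\<And>A. A \<subseteq> {1..D} \<Longrightarrow> card A = m \<Longrightarrow>
      \<exists>x\<in>A. \<exists>y\<in>A. \<exists>z\<in>A. z < y \<and> y < x \<and> \<phi> x y \<and> \<not> \<phi> x z \<and> \<phi> y z"
  shows "card (levels_below S w) \<le> m"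
proof (rule ccontr)
  assume "\<not> ?thesis"
  then have gt: "card (levels_below S w) > m" by simp
  have finL: "finite (levels_below S w)" using fin by (simp add: levels_below_def)
  define t where "t = Min (levels_below S w)"
  have ne: "levels_below S w \<noteq> {}" using gt by auto
  have t: "t \<in> levels_below S w" "\<And>x. x \<in> levels_below S w \<Longrightarrow> t \<le> x"
    using finL ne by (auto simp: t_def)
  have "card (levels_below S w - {t}) \<ge> m" using gt t(1) by simp
  then obtain A where A: "A \<subseteq> levels_below S w - {t}" "card A = m"
    by (rule obtain_subset_with_card_n) blast
  have "1 \<le> \<delta> v w \<and> \<delta> v w \<le> D" if "v \<in> S" "v < w" for v
    using that w S by (intro conjI \<delta>_pos \<delta>_le) auto
  then have "levels_below S w \<subseteq> {1..D}"
    unfolding levels_below_def by auto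
  then obtain x y z where xyz: "x \<in> A" "y \<in> A" "z \<in> A" "z < y" "y < x"
    and E: "\<phi> x y" "\<not> \<phi> x z" "\<phi> y z"
    using \<phi>[of A] A by blast
  have tz: "t < z" using t(2)[of z] A xyz by (auto simp: le_less)
  have lev: "\<exists>v. v \<in> S \<and> v < w \<and> \<delta> v w = l" if "l \<in> levels_below S w" for l
    using that unfolding levels_below_def by blast
  have "x \<in> levels_below S w" "y \<in> levels_below S w" "z \<in> levels_below S w"
    using A xyz by auto
  then obtain a b c d where abcd: "a \<in> S" "a < w" "\<delta> a w = x"
    "b \<in> S" "b < w" "\<delta> b w = y"
    "c \<in> S" "c < w" "\<delta> c w = z"
    "d \<in> S" "d < w" "\<delta> d w = t"
    using lev t(1) by metis
  \<comment> \<open>A leaf that leaves the path to \<open>w\<close> higher up lies further left and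
    has the same level to \<open>v'\<close> as to \<open>w\<close>.\<close>
  have step: "v < v' \<and> \<delta> v v' = \<delta> v w" if "v < w" "v' < w" "\<delta> v' w < \<delta> v w" for v v'
  proof -
    have "v \<noteq> v'" using that by auto
    moreover have "\<not> v' < v" using that \<delta>_max[of v' v w] by auto
    ultimately show ?thesis using that \<delta>_max[of v v' w] by auto
  qed
  have lt: "a < b" "\<delta> a b = x" "b < c" "\<delta> b c = y" "c < d" "\<delta> c d = z"
    using step[of a b] step[of b c] step[of c d] abcd xyz tz by auto
  have "edge \<phi> {a, b, c, d}" "edge \<phi> {a, b, c, w}"
    using lt abcd xyz E by (auto intro!: edgeI simp: level_edge_dec)
  moreover have "card ({a, b, c, d} \<union> {a, b, c, w}) = 5"
    using lt abcd by (auto simp: card_insert_if)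
  ultimately show False using sparseD[OF sp] abcd w by blast
qed

text \<open>Mirror image of \<open>card_levels_below\<close>: the path turns left, and the
  interchangeable vertices \<open>d\<close> and \<open>w\<close> come first in the edge.\<close>

lemma card_levels_above:
  assumes sp: "sparse \<phi> S" and fin: "finite S" and S: "S \<subseteq> {..<2 ^ D}" and w: "w \<in> S"
    and \<phi>: "\<And>A. A \<subseteq> {1..D} \<Longrightarrow> card A = m \<Longrightarrow>
      \<exists>x\<in>A. \<exists>y\<in>A. \<exists>z\<in>A. z < y \<and> y < x \<and> \<phi> x y \<and> \<not> \<phi> x z \<and> \<phi> y z"
  shows "card (levels_above S w) \<le> m"
proof (rule ccontr)
  assume "\<not> ?thesis"
  then have gt: "card (levels_above S w) > m" by simp
  have finL: "finite (levels_above S w)" using fin by (simp add: levels_above_def)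
  define t where "t = Min (levels_above S w)"
  have ne: "levels_above S w \<noteq> {}" using gt by auto
  have t: "t \<in> levels_above S w" "\<And>x. x \<in> levels_above S w \<Longrightarrow> t \<le> x"
    using finL ne by (auto simp: t_def)
  have "card (levels_above S w - {t}) \<ge> m" using gt t(1) by simp
  then obtain A where A: "A \<subseteq> levels_above S w - {t}" "card A = m"
    by (rule obtain_subset_with_card_n) blast
  have "1 \<le> \<delta> w v \<and> \<delta> w v \<le> D" if "v \<in> S" "w < v" for v
    using that w S by (intro conjI \<delta>_pos \<delta>_le) auto
  then have "levels_above S w \<subseteq> {1..D}"
    unfolding levels_above_def by auto
  then obtain x y z where xyz: "x \<in> A" "y \<in> A" "z \<in> A" "z < y" "y < x"
    and E: "\<phi> x y" "\<not> \<phi> x z" "\<phi> y z"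
    using \<phi>[of A] A by blast
  have tz: "t < z" using t(2)[of z] A xyz by (auto simp: le_less)
  have lev: "\<exists>v. v \<in> S \<and> w < v \<and> \<delta> w v = l" if "l \<in> levels_above S w" for l
    using that unfolding levels_above_def by blast
  have "x \<in> levels_above S w" "y \<in> levels_above S w" "z \<in> levels_above S w"
    using A xyz by auto
  then obtain a b c d where abcd: "a \<in> S" "w < a" "\<delta> w a = x"
    "b \<in> S" "w < b" "\<delta> w b = y"
    "c \<in> S" "w < c" "\<delta> w c = z"
    "d \<in> S" "w < d" "\<delta> w d = t"
    using lev t(1) by metis
  have step: "v' < v \<and> \<delta> v' v = \<delta> w v" if "w < v" "w < v'" "\<delta> w v' < \<delta> w v" for v v'
  proof -
    have "v \<noteq> v'" using that by auto
    moreover have "\<not> v < v'" using that \<delta>_max[of w v v'] by auto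
    ultimately show ?thesis using that \<delta>_max[of w v' v] by auto
  qed
  have lt: "b < a" "\<delta> b a = x" "c < b" "\<delta> c b = y" "d < c" "\<delta> d c = z"
    using step[of a b] step[of b c] step[of c d] abcd xyz tz by auto
  have "edge \<phi> {d, c, b, a}" "edge \<phi> {w, c, b, a}"
    using lt abcd xyz E by (auto intro!: edgeI simp: level_edge_inc)
  moreover have "card ({d, c, b, a} \<union> {w, c, b, a}) = 5"
    using lt abcd by (auto simp: card_insert_if)
  ultimately show False using sparseD[OF sp] abcd w by blast
qed

lemma sparse_mono: "sparse \<phi> S \<Longrightarrow> T \<subseteq> S \<Longrightarrow> sparse \<phi> T"
  unfolding sparse_def by blast

text \<open>The path bound is used twice. To the right of a branching with at least two left leaves,
  \<open>sparse_split_right\<close> allows \<open>K = 2\<close>, giving at most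
  \<open>1 + 4 * m\<close> leaves there; this is the \<open>K\<close> for the whole of
  \<open>S\<close>.\<close>

lemma card_sparse_le:
  assumes sp: "sparse \<phi> S" and S: "S \<subseteq> {..<2 ^ D}"
    and \<phi>: "\<And>A. A \<subseteq> {1..D} \<Longrightarrow> card A = m \<Longrightarrow>
      \<exists>x\<in>A. \<exists>y\<in>A. \<exists>z\<in>A. z < y \<and> y < x \<and> \<phi> x y \<and> \<not> \<phi> x z \<and> \<phi> y z"
  shows "card S \<le> 1 + (1 + 4 * m) * (2 * m)"
proof -
  have fin: "finite S" using S finite_subset by blast
  \<comment> \<open>At most \<open>m\<close> right turns and \<open>m\<close> left turns, each
    leaving behind at most \<open>K\<close> leaves.\<close>
  have path: "card T \<le> 1 + K * (2 * m)"
    if T: "T \<subseteq> S" and sides: "\<And>T' A B t. T' \<subseteq> T \<Longrightarrow> split_at T' A B t \<Longrightarrow> card A \<le> K \<or> card B \<le> K" for T K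
  proof (cases "T = {}")
    case False
    have finT: "finite T" using T fin finite_subset by blast
    have "\<exists>w\<in>T. card T \<le> 1 + K * (card (levels_below T w) + card (levels_above T w))"
      by (rule card_le_levels[OF finT False]) (rule sides)
    then obtain w where w: "w \<in> T" "card T \<le> 1 + K * (card (levels_below T w) + card (levels_above T w))"
      by blast
    have "card (levels_below T w) \<le> m" "card (levels_above T w) \<le> m"
      using card_levels_below[OF sparse_mono[OF sp T] finT order_trans[OF T S] w(1) \<phi>]
        card_levels_above[OF sparse_mono[OF sp T] finT order_trans[OF T S] w(1) \<phi>] by blast+
    then have "K * (card (levels_below T w) + card (levels_above T w)) \<le> K * (2 * m)"
      by (intro mult_left_mono) auto
    then show ?thesis using w(2) by linarith
  qed simp
  show ?thesis
  proof (rule path)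
    fix T A B t assume T: "T \<subseteq> S" and spl: "split_at T A B t"
    have AB: "T = A \<union> B" "\<And>a b. a \<in> A \<Longrightarrow> b \<in> B \<Longrightarrow> a < b \<and> \<delta> a b = t"
      and inA: "\<And>x y. x \<in> A \<Longrightarrow> y \<in> A \<Longrightarrow> x < y \<Longrightarrow> \<delta> x y < t"
      and inB: "\<And>x y. x \<in> B \<Longrightarrow> y \<in> B \<Longrightarrow> x < y \<Longrightarrow> \<delta> x y < t"
      using spl unfolding split_at_def by blast+
    have finA: "finite A" "A \<noteq> {}" using AB(1) T fin finite_subset spl by (auto simp: split_at_def)
    show "card A \<le> 1 + 4 * m \<or> card B \<le> 1 + 4 * m"
    proof (cases "\<exists>u u'. u \<in> A \<and> u' \<in> A \<and> u < u'")
      case False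
      then have "A \<subseteq> {Min A}" using finA by (metis Min_in Min_le order_less_le singletonI subsetI)
      then have "card A \<le> 1" using card_mono[of "{Min A}" A] by simp
      then show ?thesis by simp
    next
      case True
      then obtain u u' where u: "u \<in> A" "u' \<in> A" "u < u'" by blast
      have "card B \<le> 1 + 2 * (2 * m)"
      proof (rule path)
        show "B \<subseteq> S" using AB T by simp
        fix T' L R y assume T': "T' \<subseteq> B" and spl': "split_at T' L R y"
        have finLR: "finite L" "finite R"
          using spl' T' AB(1) T fin finite_subset unfolding split_at_def by (metis finite_Un)+
        have AT': "a < b \<and> \<delta> a b = t" if "a \<in> A" "b \<in> T'" for a b
          using AB(2) that T' by blast
        have inT': "\<delta> x y < t" if "x \<in> T'" "y \<in> T'" "x < y" for x y
          using inB that T' by blast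
        have "card L \<le> 2 \<or> card R \<le> 1"
          by (rule sparse_split_right[OF sp _ u inA[OF u] AT' inT' spl' finLR]) (use AB T T' in blast)
        then show "card L \<le> 2 \<or> card R \<le> 2" by linarith
      qed
      then show ?thesis by simp
    qed
  qed simp
qed

section \<open>From sparse sets to the Erdos-Rogers function\<close>

text \<open>A 4-subset of a 5-set is determined by its missing point, so any bijection matching the
  points missed by the edges of \<open>F\<close> with those missed by \<open>e\<close> and
  \<open>f\<close> is a copy.\<close>

lemma contains_copy_two_edges:
  fixes F :: "'a hypergraph" and X :: "'b set"
  assumes F: "uniform_hypergraph 4 F" "card (verts F) = 5" "card (edges F) = 2"
    and X: "X \<subseteq> verts H" "card X = 5" "e \<in> edges H" "f \<in> edges H" "e \<union> f = X" "card e = 4" "card f = 4"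
  shows "contains_copy F H"
proof -
  have finV: "finite (verts F)" and finX: "finite X"
    using F(2) X(2) by (metis card.infinite zero_neq_numeral)+
  have edge: "g \<subseteq> verts F \<and> card g = 4" if "g \<in> edges F" for g
    using F(1) that unfolding uniform_hypergraph_def by blast
  obtain g h where gh: "edges F = {g, h}" "g \<noteq> h" using F(3) by (meson card_2_iff)
  have miss: "\<exists>p. V - g = {p}" if "g \<subseteq> V" "card g = 4" "card V = 5" for g V :: "'c set"
  proof -
    have "finite g" using that(2) by (metis card.infinite zero_neq_numeral)
    then have "card (V - g) = 1" using that by (simp add: card_Diff_subset)
    then show ?thesis by (rule card_1_singletonE) blast
  qed
  obtain p where p: "verts F - g = {p}" using miss[of g "verts F"] edge gh F(2) by auto
  obtain q where q: "verts F - h = {q}" using miss[of h "verts F"] edge gh F(2) by auto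
  obtain a where a: "X - e = {a}" using miss[of e X] X by blast
  obtain b where b: "X - f = {b}" using miss[of f X] X by blast
  have g: "g = verts F - {p}" and h: "h = verts F - {q}" using p q edge gh by auto
  have "p \<noteq> q" using g h gh(2) by blast
  have e: "e = X - {a}" and f: "f = X - {b}" using a b X(5) by auto
  have "a \<noteq> b" using a b X(5) by blast
  have pq: "{p, q} \<subseteq> verts F" and ab: "{a, b} \<subseteq> X" using p q a b by auto
  have "card (verts F - {p, q}) = card (X - {a, b})"
    using pq ab \<open>p \<noteq> q\<close> \<open>a \<noteq> b\<close> F(2) X(2) by (simp add: card_Diff_subset)
  then obtain \<psi> where \<psi>: "bij_betw \<psi> (verts F - {p, q}) (X - {a, b})"
    using finite_same_card_bij[of "verts F - {p, q}" "X - {a, b}"] finV finX by auto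
  define \<chi> where "\<chi> v = (if v = p then a else if v = q then b else \<psi> v)" for v
  have "bij_betw \<chi> (verts F - {p, q}) (X - {a, b})"
    using \<psi> by (rule bij_betw_cong[THEN iffD1, rotated]) (auto simp: \<chi>_def)
  moreover have "bij_betw \<chi> {p, q} {a, b}"
    using \<open>p \<noteq> q\<close> \<open>a \<noteq> b\<close> by (auto simp: bij_betw_def \<chi>_def)
  ultimately have "bij_betw \<chi> ((verts F - {p, q}) \<union> {p, q}) ((X - {a, b}) \<union> {a, b})"
    by (rule bij_betw_combine) auto
  moreover have "(verts F - {p, q}) \<union> {p, q} = verts F" "(X - {a, b}) \<union> {a, b} = X"
    using pq ab by auto
  ultimately have \<chi>: "bij_betw \<chi> (verts F) X" by simp
  then have inj: "inj_on \<chi> (verts F)" and im: "\<chi> ` verts F = X" by (auto simp: bij_betw_def)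
  have "\<chi> ` g = \<chi> ` verts F - \<chi> ` {p}" "\<chi> ` h = \<chi> ` verts F - \<chi> ` {q}"
    unfolding g h by (rule inj_on_image_set_diff[OF inj]; use pq in blast)+
  then have "\<chi> ` g = e" "\<chi> ` h = f"
    unfolding im e f using \<open>p \<noteq> q\<close> by (auto simp: \<chi>_def)
  then show ?thesis
    unfolding contains_copy_def using inj im X gh(1) by (intro exI[of _ \<chi>]) auto
qed

definition level_hypergraph :: "(nat \<Rightarrow> nat \<Rightarrow> bool) \<Rightarrow> nat \<Rightarrow> nat hypergraph" where
  "level_hypergraph \<phi> N = ({..<N}, {e. e \<subseteq> {..<N} \<and> edge \<phi> e})"

lemma uniform_level_hypergraph: "uniform_hypergraph 4 (level_hypergraph \<phi> N)"
  by (auto simp: uniform_hypergraph_def level_hypergraph_def card_edge)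

lemma level_hypergraph_K6_free: "\<not> contains_copy (complete_hypergraph 4 6) (level_hypergraph \<phi> N)"
proof
  assume "contains_copy (complete_hypergraph 4 6) (level_hypergraph \<phi> N)"
  then obtain \<psi> :: "nat \<Rightarrow> nat" where inj: "inj_on \<psi> {..<6}"
    and edges: "\<And>e. e \<subseteq> {..<6} \<Longrightarrow> card e = 4 \<Longrightarrow> edge \<phi> (\<psi> ` e)"
    unfolding contains_copy_def complete_hypergraph_def level_hypergraph_def by auto
  show False
  proof (rule no_clique)
    show "card (\<psi> ` {..<6}) = 6" using card_image[OF inj] by simp
    fix e assume "e \<subseteq> \<psi> ` {..<6}" "card e = 4"
    then obtain c where c: "c \<subseteq> {..<6}" "e = \<psi> ` c" by (auto simp: subset_image_iff)
    then have "card c = 4" using \<open>card e = 4\<close> inj_on_subset[OF inj] card_image by metis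
    then show "edge \<phi> e" using edges c by blast
  qed
qed

lemma indep_set_imp_sparse:
  assumes F: "uniform_hypergraph 4 F" "card (verts F) = 5" "card (edges F) = 2"
    and S: "indep_set F (level_hypergraph \<phi> N) S"
  shows "sparse \<phi> S"
  unfolding sparse_def
proof (intro allI impI notI)
  fix e f assume ef: "edge \<phi> e \<and> edge \<phi> f \<and> e \<union> f \<subseteq> S" "card (e \<union> f) = 5"
  have "S \<subseteq> {..<N}" using S by (simp add: indep_set_def level_hypergraph_def)
  then have "contains_copy F (induced (level_hypergraph \<phi> N) S)"
    using ef by (intro contains_copy_two_edges[OF F, of "e \<union> f" _ e f])
      (auto simp: induced_def level_hypergraph_def card_edge)
  then show False using S by (simp add: indep_set_def)
qed

lemma erdos_rogers_le:
  assumes F: "uniform_hypergraph 4 F" "card (verts F) = 5" "card (edges F) = 2"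
    and d: "d \<ge> 1" and N: "N \<le> 2 ^ (2 ^ d)"
  shows "erdos_rogers 4 F 6 N \<le> 20000 * d\<^sup>2"
proof -
  \<comment> \<open>Distinct leaves below \<open>2 ^ (2 ^ d)\<close> have levels in
    \<open>{1..2 ^ d}\<close>, and a colouring of that many levels costs only \<open>48 * d\<close>:
    this yields the second logarithm.\<close>
  have "\<exists>\<phi>. \<forall>A. A \<subseteq> {1..(2::nat) ^ d} \<and> card A = 48 * d \<longrightarrow>
      (\<exists>x\<in>A. \<exists>y\<in>A. \<exists>z\<in>A. z < y \<and> y < x \<and> \<phi> x y \<and> \<not> \<phi> x z \<and> \<phi> y z)"
    by (rule exists_pattern_colouring) (use d in auto)
  then obtain \<phi> where "\<forall>A. A \<subseteq> {1..(2::nat) ^ d} \<and> card A = 48 * d \<longrightarrow>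
      (\<exists>x\<in>A. \<exists>y\<in>A. \<exists>z\<in>A. z < y \<and> y < x \<and> \<phi> x y \<and> \<not> \<phi> x z \<and> \<phi> y z)"
    by (rule exE)
  note \<phi> = this[rule_format, OF conjI]
  let ?H = "level_hypergraph \<phi> N"
  have bound: "card S \<le> 20000 * d\<^sup>2" if S: "indep_set F ?H S" for S
  proof -
    have "S \<subseteq> {..<2 ^ (2 ^ d)}"
      using S N by (force simp: indep_set_def level_hypergraph_def)
    then have "card S \<le> 1 + (1 + 4 * (48 * d)) * (2 * (48 * d))"
      by (rule card_sparse_le[OF indep_set_imp_sparse[OF F S] _ \<phi>])
    also have "\<dots> = 1 + 96 * d + 18432 * d\<^sup>2" by (simp add: power2_eq_square algebra_simps)
    \<comment> \<open>The lower terms are absorbed using \<open>d \<ge> 1\<close>; 20000 rounds up 1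
      + 96 + 18432.\<close>
    also have "\<dots> \<le> d\<^sup>2 + 96 * d\<^sup>2 + 18432 * d\<^sup>2"
      using d by (intro add_mono mult_left_mono) (simp_all add: power2_eq_square)
    also have "\<dots> \<le> 20000 * d\<^sup>2" by simp
    finally show ?thesis .
  qed
  have "\<not> contains_copy F (induced ?H {})"
    using F(2) unfolding contains_copy_def induced_def by auto
  then have "indep_set F ?H {}" by (simp add: indep_set_def)
  then have "{card S | S. indep_set F ?H S} \<noteq> {}" by blast
  moreover have le: "{card S | S. indep_set F ?H S} \<subseteq> {..20000 * d\<^sup>2}"
    using bound by blast
  moreover have "finite {card S | S. indep_set F ?H S}"
    using le finite_atMost by (rule finite_subset)
  ultimately have "indep_number F ?H \<le> 20000 * d\<^sup>2"
    unfolding indep_number_def by (metis (no_types, lifting) Max_in atMost_iff subsetD)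
  moreover have "erdos_rogers 4 F 6 N \<le> indep_number F ?H"
    unfolding erdos_rogers_def
  proof (rule cInf_lower, rule CollectI, intro exI[of _ ?H] conjI refl)
    show "card (verts ?H) = N" by (simp add: level_hypergraph_def)
  qed (use uniform_level_hypergraph level_hypergraph_K6_free in auto)
  ultimately show ?thesis by simp
qed

theorem theorem1p5:
  fixes F :: "'a hypergraph"
  assumes "uniform_hypergraph 4 F" and "card (verts F) = 5" and "card (edges F) = 2"
  shows "(\<lambda>N. real (erdos_rogers 4 F 6 N)) \<in> O(\<lambda>N. (log 2 (log 2 (real N)))\<^sup>2)"
proof (rule bigoI[where c = 80000])
  \<comment> \<open>From \<open>N \<ge> 4\<close> on, the iterated logarithm is at least 1, so
    rounding it up to \<open>d\<close> at most doubles it; squaring turns 20000 into 80000.\<close>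
  have "norm (real (erdos_rogers 4 F 6 N)) \<le> 80000 * norm ((log 2 (log 2 (real N)))\<^sup>2)" if "N \<ge> 4" for N
  proof -
    let ?l = "log 2 (log 2 (real N))"
    define d where "d = nat \<lceil>?l\<rceil>"
    have "log 2 4 \<le> log 2 (real N)" using that by (subst log_le_cancel_iff) auto
    moreover have "log 2 4 = (2::real)" using log_pow_cancel[of 2 2] by simp
    ultimately have l2: "log 2 (real N) \<ge> 2" by simp
    then have "log 2 2 \<le> ?l" by (subst log_le_cancel_iff) auto
    then have l1: "?l \<ge> 1" by simp
    then have d: "?l \<le> real d" "real d \<le> 2 * ?l" "d \<ge> 1" unfolding d_def by linarith+
    have "log 2 (real N) \<le> 2 powr real d" using d(1) l2 by (subst (asm) log_le_iff) auto
    then have "real N \<le> 2 powr (2 powr real d)" using that by (subst (asm) log_le_iff) auto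
    also have "\<dots> = 2 powr real (2 ^ d)" by (simp add: powr_realpow)
    also have "\<dots> = real (2 ^ (2 ^ d))" by (subst powr_realpow) simp_all
    finally have "N \<le> 2 ^ (2 ^ d)" by (simp only: of_nat_le_iff)
    then have "real (erdos_rogers 4 F 6 N) \<le> real (20000 * d\<^sup>2)"
      using erdos_rogers_le[OF assms d(3)] by (simp only: of_nat_le_iff)
    also have "\<dots> = 20000 * (real d)\<^sup>2" by simp
    also have "\<dots> \<le> 20000 * (2 * ?l)\<^sup>2" using d(2) by (intro mult_left_mono power_mono) auto
    finally show ?thesis by (simp add: power_mult_distrib)
  qed
  then show "\<forall>\<^sub>F N in at_top. norm (real (erdos_rogers 4 F 6 N)) \<le> 80000 * norm ((log 2 (log 2 (real N)))\<^sup>2)"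
    by (rule eventually_at_top_linorderI)
qed

end
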